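(* Let $A$ be a commutative ring with identity. Then $\operatorname{Spec} A$, with the Zariski topology, is a dense subspace of $\operatorname{Sq} A$.
   Context: A proper ideal $\mathfrak{q}$ of $A$ is called quasi-prime if whenever $fg\in\mathfrak{q}$ with $f,g\in A$, then $f\in\sqrt{\mathfrak{q}}$ or $g\in\sqrt{\mathfrak{q}}$. The quasi-prime spectrum $\operatorname{Sq} A$ is the set of all quasi-prime ideals of $A$ (it contains $\operatorname{Spec} A$ as a subset), with the topology having as basis of opens the sets $U_f=\{\mathfrak{q}\in\operatorname{Sq} A: \mathfrak{q}\cap S_f=\emptyset\}$ for $f\in A$, where $S_f=\{f^i : i\ge 0\}=\{1,f,f^2,\dots\}$. *)

theory Defs
  imports "HOL-Analysis.Abstract_Topology" "HOL-Algebra.Ideal"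
begin

definition radical :: "('a, 'b) ring_scheme \<Rightarrow> 'a set \<Rightarrow> 'a set" where
  "radical A I = {x \<in> carrier A. \<exists>n::nat. n > 0 \<and> x [^]\<^bsub>A\<^esub> n \<in> I}"

definition quasi_prime :: "('a, 'b) ring_scheme \<Rightarrow> 'a set \<Rightarrow> bool" where
  "quasi_prime A q \<longleftrightarrow> ideal q A \<and> q \<noteq> carrier A \<and>
     (\<forall>f\<in>carrier A. \<forall>g\<in>carrier A.
        f \<otimes>\<^bsub>A\<^esub> g \<in> q \<longrightarrow> f \<in> radical A q \<or> g \<in> radical A q)"

definition Spec :: "('a, 'b) ring_scheme \<Rightarrow> 'a set set" where
  "Spec A = {p. primeideal p A}"

definition Sq :: "('a, 'b) ring_scheme \<Rightarrow> 'a set set" where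
  "Sq A = {q. quasi_prime A q}"

definition powers :: "('a, 'b) ring_scheme \<Rightarrow> 'a \<Rightarrow> 'a set" where
  "powers A f = {f [^]\<^bsub>A\<^esub> i | i::nat. True}"

definition basic_open :: "('a, 'b) ring_scheme \<Rightarrow> 'a \<Rightarrow> 'a set set" where
  "basic_open A f = {q \<in> Sq A. q \<inter> powers A f = {}}"

definition Sq_topology :: "('a, 'b) ring_scheme \<Rightarrow> 'a set topology" where
  "Sq_topology A = topology (arbitrary union_of (\<lambda>U. \<exists>f\<in>carrier A. U = basic_open A f))"

definition zero_locus :: "('a, 'b) ring_scheme \<Rightarrow> 'a set \<Rightarrow> 'a set set" where
  "zero_locus A I = {p \<in> Spec A. I \<subseteq> p}"

definition Zariski_topology :: "('a, 'b) ring_scheme \<Rightarrow> 'a set topology" where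
  "Zariski_topology A = topology (\<lambda>U. \<exists>I. ideal I A \<and> U = Spec A - zero_locus A I)"

text \<open>
  The constant \<^const>\<open>topology\<close> is only meaningful on predicates satisfying
  \<^const>\<open>istopology\<close>; the following lemmas establish this for both topologies.
\<close>

lemma basic_open_Int:
  assumes "cring A" and f: "f \<in> carrier A" and g: "g \<in> carrier A"
  shows "basic_open A f \<inter> basic_open A g = basic_open A (f \<otimes>\<^bsub>A\<^esub> g)"
proof -
  interpret cring A by fact
  have "q \<inter> powers A (f \<otimes>\<^bsub>A\<^esub> g) = {} \<longleftrightarrow> q \<inter> powers A f = {} \<and> q \<inter> powers A g = {}"
    if "quasi_prime A q" for q
  proof -
    interpret ideal q A using that by (simp add: quasi_prime_def)
    have pw: "(f \<otimes>\<^bsub>A\<^esub> g) [^]\<^bsub>A\<^esub> i = f [^]\<^bsub>A\<^esub> i \<otimes>\<^bsub>A\<^esub> g [^]\<^bsub>A\<^esub> i" for i :: nat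
      using f g by (simp add: nat_pow_distrib)
    have "q \<inter> powers A f \<noteq> {} \<or> q \<inter> powers A g \<noteq> {}"
      if ne: "q \<inter> powers A (f \<otimes>\<^bsub>A\<^esub> g) \<noteq> {}"
    proof -
      obtain i :: nat where "f [^]\<^bsub>A\<^esub> i \<otimes>\<^bsub>A\<^esub> g [^]\<^bsub>A\<^esub> i \<in> q"
        using ne pw by (auto simp: powers_def)
      then have "f [^]\<^bsub>A\<^esub> i \<in> radical A q \<or> g [^]\<^bsub>A\<^esub> i \<in> radical A q"
        using \<open>quasi_prime A q\<close> f g by (simp add: quasi_prime_def)
      then show ?thesis
        using f g by (force simp: radical_def powers_def nat_pow_pow)
    qed
    moreover have "q \<inter> powers A (f \<otimes>\<^bsub>A\<^esub> g) \<noteq> {}"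
      if ne: "q \<inter> powers A f \<noteq> {} \<or> q \<inter> powers A g \<noteq> {}"
    proof -
      obtain i :: nat where "f [^]\<^bsub>A\<^esub> i \<in> q \<or> g [^]\<^bsub>A\<^esub> i \<in> q"
        using ne unfolding powers_def by blast
      then have "(f \<otimes>\<^bsub>A\<^esub> g) [^]\<^bsub>A\<^esub> i \<in> q"
        using f g pw I_l_closed I_r_closed by auto
      then show ?thesis by (auto simp: powers_def)
    qed
    ultimately show ?thesis by blast
  qed
  then show ?thesis by (auto simp: basic_open_def Sq_def)
qed

lemma openin_Sq_topology:
  assumes "cring A"
  shows "openin (Sq_topology A) =
    arbitrary union_of (\<lambda>U. \<exists>f\<in>carrier A. U = basic_open A f)"
proof -
  interpret cring A by fact
  show ?thesis
    unfolding Sq_topology_def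
    by (intro topology_inverse' istopology_base) (metis assms basic_open_Int m_closed)
qed

lemma zero_locus_Int:
  assumes "cring A" "ideal I A" "ideal J A"
  shows "zero_locus A (I \<inter> J) = zero_locus A I \<union> zero_locus A J"
proof -
  interpret cring A by fact
  interpret I: ideal I A by fact
  interpret J: ideal J A by fact
  have "I \<subseteq> p \<or> J \<subseteq> p" if p: "primeideal p A" and sub: "I \<inter> J \<subseteq> p" for p
  proof (rule ccontr)
    assume "\<not> ?thesis"
    then obtain x y where xy: "x \<in> I" "x \<notin> p" "y \<in> J" "y \<notin> p" by blast
    then have "x \<in> carrier A" "y \<in> carrier A" using I.a_Hcarr J.a_Hcarr by auto
    moreover from this xy have "x \<otimes>\<^bsub>A\<^esub> y \<in> I \<inter> J"
      using I.I_r_closed J.I_l_closed by simp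
    ultimately show False using primeideal.I_prime[OF p] xy sub by blast
  qed
  then show ?thesis by (auto simp: zero_locus_def Spec_def)
qed

lemma openin_Zariski_topology:
  assumes "cring A"
  shows "openin (Zariski_topology A) U \<longleftrightarrow> (\<exists>I. ideal I A \<and> U = Spec A - zero_locus A I)"
proof -
  interpret cring A by fact
  let ?P = "\<lambda>U. \<exists>I. ideal I A \<and> U = Spec A - zero_locus A I"
  have "istopology ?P"
    unfolding istopology_def
  proof (intro conjI allI impI)
    fix S T assume "?P S" "?P T"
    then obtain I J where "ideal I A" "S = Spec A - zero_locus A I"
      and "ideal J A" "T = Spec A - zero_locus A J" by blast
    then show "?P (S \<inter> T)"
      using zero_locus_Int[OF assms] i_intersect by (intro exI[of _ "I \<inter> J"]) auto
  next
    fix K assume "\<forall>U\<in>K. ?P U"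
    then obtain I where I: "\<And>U. U \<in> K \<Longrightarrow> ideal (I U) A"
      "\<And>U. U \<in> K \<Longrightarrow> U = Spec A - zero_locus A (I U)" by metis
    define S where "S = (\<Union>U\<in>K. I U)"
    have S: "S \<subseteq> carrier A"
      using I(1) additive_subgroup.a_subset[OF ideal.axioms(1)] by (fastforce simp: S_def)
    have eq: "Idl\<^bsub>A\<^esub> S \<subseteq> p \<longleftrightarrow> (\<forall>U\<in>K. I U \<subseteq> p)" if "p \<in> Spec A" for p
    proof -
      have "ideal p A" using that by (simp add: Spec_def primeideal.axioms(1))
      then show ?thesis
        using genideal_minimal[of p S] genideal_self[OF S] by (auto simp: S_def)
    qed
    have "x \<in> \<Union>K \<longleftrightarrow> x \<in> Spec A - zero_locus A (Idl\<^bsub>A\<^esub> S)" for x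
    proof -
      have "x \<in> \<Union>K \<longleftrightarrow> (\<exists>U\<in>K. x \<in> Spec A - zero_locus A (I U))"
        using I(2) by auto
      also have "\<dots> \<longleftrightarrow> x \<in> Spec A - zero_locus A (Idl\<^bsub>A\<^esub> S)"
        using eq by (auto simp: zero_locus_def)
      finally show ?thesis .
    qed
    then have "\<Union>K = Spec A - zero_locus A (Idl\<^bsub>A\<^esub> S)" by blast
    then show "?P (\<Union>K)" using genideal_ideal[OF S] by blast
  qed
  then show ?thesis by (simp add: Zariski_topology_def topology_inverse')
qed

lemma topspace_Sq_topology:
  assumes "cring A"
  shows "topspace (Sq_topology A) = Sq A"
proof
  interpret cring A by fact
  show "topspace (Sq_topology A) \<subseteq> Sq A"
    unfolding topspace_def openin_Sq_topology[OF assms]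
    by (auto simp: union_of_def basic_open_def)
  have "q \<inter> powers A \<one>\<^bsub>A\<^esub> = {}" if "q \<in> Sq A" for q
    using that ideal.one_imp_carrier by (auto simp: powers_def Sq_def quasi_prime_def)
  then have "Sq A = basic_open A \<one>\<^bsub>A\<^esub>" by (auto simp: basic_open_def)
  then have "openin (Sq_topology A) (Sq A)"
    unfolding openin_Sq_topology[OF assms] by (intro arbitrary_union_of_inc) auto
  then show "Sq A \<subseteq> topspace (Sq_topology A)" by (rule openin_subset)
qed

end

theory Submission
  imports Defs
begin

text \<open>
  A proper ideal \<open>q\<close> lies in the basic open set of \<open>f\<close> exactly when \<open>f\<close> is not in the radical of
  \<open>q\<close>, so membership in a basic open set depends on the radical alone.

  Prime ideals are their own radicals, which makes them quasi-prime, and the basic open set of \<open>f\<close>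
  cuts out on the prime spectrum the primes not containing \<open>f\<close>. These are the principal open sets
  of the Zariski topology: the complement of the zero locus of an ideal \<open>I\<close> is the union of the
  principal open sets of the elements of \<open>I\<close>, and any union of principal open sets is the
  complement of the zero locus of the ideal generated by the elements involved. So the Zariski
  topology is the subspace topology.

  For density, the quasi-prime condition says precisely that the radical of a quasi-prime ideal
  is prime. If a basic open set contains \<open>q\<close>, then it also contains the radical of \<open>q\<close>, because
  \<open>q\<close> and its radical have the same radical. Hence every nonempty open set contains a prime.
\<close>

text \<open>
  Carrying the factor \<open>z\<close> replaces the binomial theorem: one factor \<open>x \<oplus> y\<close> is split off at
  a time, and \<open>x\<close> or \<open>y\<close> is absorbed into \<open>z\<close>.
\<close>

lemma (in ideal) mult_add_pow_mem:
  assumes "cring R" and x: "x \<in> carrier R" and y: "y \<in> carrier R"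
  shows "\<lbrakk>z \<in> carrier R; z \<otimes> x [^] (m::nat) \<in> I; z \<otimes> y [^] (n::nat) \<in> I\<rbrakk>
    \<Longrightarrow> z \<otimes> (x \<oplus> y) [^] (m + n) \<in> I"
proof (induction "m + n" arbitrary: z m n)
  case 0
  then show ?case by simp
next
  case (Suc k)
  interpret cring R by fact
  consider "m = 0 \<or> n = 0" | m' n' where "m = Suc m'" "n = Suc n'"
    by (cases m; cases n) auto
  then show ?case
  proof cases
    case 1
    then have "z \<in> I" using Suc.prems by auto
    then show ?thesis using x y by (simp add: I_r_closed)
  next
    case 2
    have "z \<otimes> y \<otimes> x [^] m = z \<otimes> x [^] m \<otimes> y" "z \<otimes> x \<otimes> y [^] n = z \<otimes> y [^] n \<otimes> x"
      using Suc.prems(1) x y by (simp_all add: m_ac)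
    then have mixed: "z \<otimes> y \<otimes> x [^] m \<in> I" "z \<otimes> x \<otimes> y [^] n \<in> I"
      using Suc.prems x y by (simp_all add: I_r_closed)
    have "z \<otimes> x \<otimes> x [^] m' = z \<otimes> x [^] m" "z \<otimes> y \<otimes> y [^] n' = z \<otimes> y [^] n"
      using Suc.prems(1) x y 2 by (simp_all add: m_ac)
    then have "z \<otimes> x \<otimes> (x \<oplus> y) [^] (m' + n) \<in> I" "z \<otimes> y \<otimes> (x \<oplus> y) [^] (m + n') \<in> I"
      using Suc.hyps(1)[of m' n "z \<otimes> x"] Suc.hyps(1)[of m n' "z \<otimes> y"]
        Suc.hyps(2) Suc.prems x y 2 mixed by simp_all
    moreover have "m' + n = k" "m + n' = k" "m + n = Suc k"
      using Suc.hyps(2) 2 by simp_all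
    moreover have "z \<otimes> (x \<oplus> y) [^] Suc k =
        z \<otimes> x \<otimes> (x \<oplus> y) [^] k \<oplus> z \<otimes> y \<otimes> (x \<oplus> y) [^] k"
      using Suc.prems(1) x y by (simp add: m_ac l_distr r_distr)
    ultimately show ?thesis by (simp add: a_closed)
  qed
qed

lemma subset_radical:
  assumes "ideal q A"
  shows "q \<subseteq> radical A q"
proof
  interpret ideal q A by fact
  fix x assume x: "x \<in> q"
  then have "x [^]\<^bsub>A\<^esub> (1::nat) \<in> q" by (simp add: Icarr)
  then show "x \<in> radical A q"
    using x by (auto simp: radical_def Icarr intro!: exI[of _ 1])
qed

lemma ideal_radical:
  assumes "cring A" and "ideal q A"
  shows "ideal (radical A q) A"
proof -
  interpret cring A by fact
  interpret q: ideal q A by fact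
  have pow: "(x \<otimes>\<^bsub>A\<^esub> a) [^]\<^bsub>A\<^esub> n \<in> q"
    if "x \<in> carrier A" "a \<in> carrier A" "x [^]\<^bsub>A\<^esub> n \<in> q" for x a and n :: nat
    using that by (simp add: nat_pow_distrib q.I_r_closed)
  have mult: "x \<otimes>\<^bsub>A\<^esub> a \<in> radical A q" if "x \<in> radical A q" "a \<in> carrier A" for x a
    using that pow by (auto simp: radical_def)
  have add: "x \<oplus>\<^bsub>A\<^esub> y \<in> radical A q" if xy: "x \<in> radical A q" "y \<in> radical A q" for x y
  proof -
    obtain m n :: nat where "m > 0" "x [^]\<^bsub>A\<^esub> m \<in> q" "y [^]\<^bsub>A\<^esub> n \<in> q"
      and c: "x \<in> carrier A" "y \<in> carrier A"
      using xy by (auto simp: radical_def)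
    then have "(x \<oplus>\<^bsub>A\<^esub> y) [^]\<^bsub>A\<^esub> (m + n) \<in> q"
      using q.mult_add_pow_mem[OF \<open>cring A\<close> c, of "\<one>\<^bsub>A\<^esub>" m n] by simp
    with \<open>m > 0\<close> c show ?thesis
      unfolding radical_def by (auto intro!: exI[of _ "m + n"])
  qed
  have zero: "\<zero>\<^bsub>A\<^esub> \<in> radical A q"
    using subset_radical[OF \<open>ideal q A\<close>] q.zero_closed by blast
  have neg: "\<ominus>\<^bsub>A\<^esub> x \<in> radical A q" if "x \<in> radical A q" for x
    using mult[OF that, of "\<ominus>\<^bsub>A\<^esub> \<one>\<^bsub>A\<^esub>"] that by (simp add: radical_def r_minus)
  show ?thesis
  proof (intro idealI ring_axioms)
    show "subgroup (radical A q) (add_monoid A)"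
      using add zero neg
      by unfold_locales (auto simp: radical_def a_inv_def[symmetric])
  qed (use mult in \<open>auto simp: radical_def m_comm\<close>)
qed

lemma one_in_radical_iff:
  assumes "ideal q A"
  shows "\<one>\<^bsub>A\<^esub> \<in> radical A q \<longleftrightarrow> q = carrier A"
proof -
  interpret ideal q A by fact
  show ?thesis using one_imp_carrier by (auto simp: radical_def)
qed

text \<open>
  Properness accounts for the exponent \<open>0\<close>, which the powers of \<open>f\<close> include and the radical excludes.
\<close>

lemma disjoint_powers_iff:
  assumes "ideal q A" "q \<noteq> carrier A" "f \<in> carrier A"
  shows "q \<inter> powers A f = {} \<longleftrightarrow> f \<notin> radical A q"
proof -
  interpret ideal q A by fact
  have "\<one>\<^bsub>A\<^esub> \<notin> q" using assms(2) one_imp_carrier by blast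
  then have "f [^]\<^bsub>A\<^esub> n \<in> q \<Longrightarrow> n > 0" for n :: nat by (cases n) auto
  then show ?thesis using assms(3) unfolding radical_def powers_def by blast
qed

lemma radical_primeideal:
  assumes "primeideal p A"
  shows "radical A p = p"
proof -
  interpret primeideal p A by fact
  have "x \<in> p" if "x \<in> carrier A" "x [^]\<^bsub>A\<^esub> n \<in> p" for x and n :: nat
    using that(2)
  proof (induction n)
    case 0
    then show ?case using one_imp_carrier I_notcarr by auto
  next
    case (Suc n)
    then show ?case using I_prime[of "x [^]\<^bsub>A\<^esub> n" x] that(1) by auto
  qed
  then show ?thesis using subset_radical[OF is_ideal] by (auto simp: radical_def)
qed

lemma radical_radical:
  assumes "cring A"
  shows "radical A (radical A q) = radical A q"
proof -
  interpret cring A by fact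
  have "x \<in> radical A q" if "x \<in> radical A (radical A q)" for x
  proof -
    obtain m n :: nat where "x \<in> carrier A" "m > 0" "n > 0" "(x [^]\<^bsub>A\<^esub> m) [^]\<^bsub>A\<^esub> n \<in> q"
      using \<open>x \<in> radical A (radical A q)\<close> unfolding radical_def by blast
    then show ?thesis by (auto simp: radical_def nat_pow_pow intro!: exI[of _ "m * n"])
  qed
  moreover have "x \<in> radical A (radical A q)" if "x \<in> radical A q" for x
  proof -
    have x: "x \<in> carrier A" using that by (simp add: radical_def)
    then have "x [^]\<^bsub>A\<^esub> (1::nat) \<in> radical A q" using that by simp
    then show ?thesis
      using x zero_less_one unfolding radical_def[of A "radical A q"] by blast
  qed
  ultimately show ?thesis by blast
qed

lemma primeideal_radical:
  assumes "cring A" and q: "quasi_prime A q"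
  shows "primeideal (radical A q) A"
proof -
  interpret cring A by fact
  have iq: "ideal q A" and neq: "q \<noteq> carrier A" using q by (auto simp: quasi_prime_def)
  show ?thesis
  proof (intro primeidealI ideal_radical assms iq)
    show "carrier A \<noteq> radical A q"
      using one_in_radical_iff[OF iq] neq one_closed by blast
  next
    fix a b assume ab: "a \<in> carrier A" "b \<in> carrier A" "a \<otimes>\<^bsub>A\<^esub> b \<in> radical A q"
    then obtain n :: nat where n: "n > 0" "(a \<otimes>\<^bsub>A\<^esub> b) [^]\<^bsub>A\<^esub> n \<in> q"
      by (auto simp: radical_def)
    have "a [^]\<^bsub>A\<^esub> n \<in> radical A q \<or> b [^]\<^bsub>A\<^esub> n \<in> radical A q"
      using q ab n(2) by (simp add: quasi_prime_def nat_pow_distrib)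
    then have "a \<in> radical A (radical A q) \<or> b \<in> radical A (radical A q)"
      using n(1) ab unfolding radical_def[of A "radical A q"] by blast
    then show "a \<in> radical A q \<or> b \<in> radical A q"
      by (simp only: radical_radical[OF \<open>cring A\<close>])
  qed
qed

lemma Spec_subset_Sq: "Spec A \<subseteq> Sq A"
proof
  fix p assume "p \<in> Spec A"
  then have p: "primeideal p A" by (simp add: Spec_def)
  then show "p \<in> Sq A"
    using primeideal.axioms(1)[OF p] primeideal.I_notcarr[OF p] primeideal.I_prime[OF p]
    by (auto simp: Sq_def quasi_prime_def radical_primeideal)
qed

lemma mem_basic_open_iff:
  assumes "f \<in> carrier A"
  shows "q \<in> basic_open A f \<longleftrightarrow> q \<in> Sq A \<and> f \<notin> radical A q"
  using disjoint_powers_iff[OF _ _ assms, of q]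
  by (auto simp: basic_open_def Sq_def quasi_prime_def)

lemma Spec_mem_basic_open_iff:
  assumes "f \<in> carrier A" "p \<in> Spec A"
  shows "p \<in> basic_open A f \<longleftrightarrow> f \<notin> p"
proof -
  have "radical A p = p" using assms(2) by (simp add: Spec_def radical_primeideal)
  then show ?thesis
    using assms Spec_subset_Sq[of A] by (auto simp: mem_basic_open_iff)
qed

lemma openin_Sq_topology_iff:
  assumes "cring A"
  shows "openin (Sq_topology A) U \<longleftrightarrow> (\<exists>F\<subseteq>carrier A. U = (\<Union>f\<in>F. basic_open A f))"
proof -
  have "openin (Sq_topology A) U \<longleftrightarrow>
      (\<exists>\<U>. \<U> \<subseteq> basic_open A ` carrier A \<and> U = \<Union>\<U>)"
    unfolding openin_Sq_topology[OF assms] union_of_def arbitrary_def by blast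
  then show ?thesis by (metis subset_image_iff image_mono)
qed

lemma Spec_Int_Union_basic_open:
  assumes "cring A" "F \<subseteq> carrier A"
  shows "(\<Union>f\<in>F. basic_open A f) \<inter> Spec A = Spec A - zero_locus A (Idl\<^bsub>A\<^esub> F)"
proof -
  interpret cring A by fact
  have "Idl\<^bsub>A\<^esub> F \<subseteq> p \<longleftrightarrow> F \<subseteq> p" if "p \<in> Spec A" for p
    using genideal_self[OF assms(2)] genideal_minimal[of p F] primeideal.axioms(1) that
    unfolding Spec_def by blast
  moreover have "p \<in> (\<Union>f\<in>F. basic_open A f) \<longleftrightarrow> \<not> F \<subseteq> p" if "p \<in> Spec A" for p
    using Spec_mem_basic_open_iff[OF _ that] assms(2) by blast
  ultimately show ?thesis unfolding zero_locus_def by blast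
qed

lemma Zariski_topology_eq_subtopology:
  assumes "cring A"
  shows "Zariski_topology A = subtopology (Sq_topology A) (Spec A)"
proof -
  interpret cring A by fact
  have "openin (Zariski_topology A) U \<longleftrightarrow> openin (subtopology (Sq_topology A) (Spec A)) U" for U
  proof
    assume "openin (Zariski_topology A) U"
    then obtain I where I: "ideal I A" "U = Spec A - zero_locus A I"
      unfolding openin_Zariski_topology[OF assms] by blast
    have "I \<subseteq> carrier A" using ideal.Icarr[OF I(1)] by blast
    moreover from this have "Idl\<^bsub>A\<^esub> I = I"
      using genideal_self genideal_minimal[OF I(1)] by blast
    ultimately show "openin (subtopology (Sq_topology A) (Spec A)) U"
      unfolding openin_subtopology openin_Sq_topology_iff[OF assms]
      using Spec_Int_Union_basic_open[OF assms, of I] I(2) by metis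
  next
    assume "openin (subtopology (Sq_topology A) (Spec A)) U"
    then obtain F where "F \<subseteq> carrier A" "U = (\<Union>f\<in>F. basic_open A f) \<inter> Spec A"
      unfolding openin_subtopology openin_Sq_topology_iff[OF assms] by blast
    then show "openin (Zariski_topology A) U"
      unfolding openin_Zariski_topology[OF assms]
      using Spec_Int_Union_basic_open[OF assms] genideal_ideal by blast
  qed
  then show ?thesis by (simp add: topology_eq)
qed

text \<open>
  The radical of \<open>q\<close> is a prime in every open neighbourhood of \<open>q\<close>, so one point
  of the prime spectrum serves all neighbourhoods at once.
\<close>

lemma radical_mem_open:
  assumes "cring A" "openin (Sq_topology A) U" "q \<in> U"
  shows "radical A q \<in> Spec A \<inter> U"
proof -
  obtain f where f: "f \<in> carrier A" "q \<in> basic_open A f" "basic_open A f \<subseteq> U"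
    using assms(2,3) unfolding openin_Sq_topology_iff[OF assms(1)] by blast
  then have spec: "radical A q \<in> Spec A"
    using primeideal_radical[OF assms(1)] by (simp add: Spec_def basic_open_def Sq_def)
  then have "radical A q \<in> basic_open A f"
    using f by (simp add: Spec_mem_basic_open_iff mem_basic_open_iff)
  with spec f(3) show ?thesis by blast
qed

theorem mainTheorem8:
  fixes A :: "('a, 'b) ring_scheme"
  assumes "cring A"
  shows "Spec A \<subseteq> Sq A
    \<and> Zariski_topology A = subtopology (Sq_topology A) (Spec A)
    \<and> Sq_topology A closure_of Spec A = Sq A"
proof (intro conjI)
  show "Spec A \<subseteq> Sq A" by (rule Spec_subset_Sq)
  show "Zariski_topology A = subtopology (Sq_topology A) (Spec A)"
    by (rule Zariski_topology_eq_subtopology[OF assms])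
  show "Sq_topology A closure_of Spec A = Sq A"
    using radical_mem_open[OF assms]
    unfolding closure_of_def topspace_Sq_topology[OF assms] by blast
qed

end
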